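(* With parameters $k$ and $x$, $$\int_0^\pi \theta \sin \theta \left[(1+x\cos\theta)^{1/k}+(1-x\cos \theta)^{1/k}\right]d\theta=\frac{\pi k}{(k+1)x}\left[(1+x)^{(k+1)/k}-(1-x)^{(k+1)/k}\right].$$
   Context: Here $k$ and $x$ are parameters for which no explicit range is specified; the identity generalizes Russell's integral, which is the case $k=3$. *)

theory Defs
  imports "HOL-Analysis.Analysis"
begin

end

theory Submission imports Defs begin

text \<open>
  With \<open>a = (k + 1) / k\<close>, the function
  \<open>F \<theta> = ((1 - x cos \<theta>)\<^sup>a - (1 + x cos \<theta>)\<^sup>a) / (a x)\<close> is an antiderivative of the integrand without
  the factor \<open>\<theta>\<close>, and it is odd about \<open>\<pi>/2\<close>. Integration by parts therefore leaves only the boundary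
  term \<open>\<pi> F \<pi>\<close>. If \<open>1 \<plusminus> x cos \<theta>\<close> meets the branch cut, then \<open>x\<close> is real and the path runs along the
  cut, where the principal power is still differentiable as a function of a real variable except
  at the origin; there \<open>Re a > 0\<close> gives continuity, which suffices for the fundamental theorem
  of calculus with finitely many exceptional points.
\<close>

text \<open>For positive \<open>u\<close> this is the complex derivative restricted to the real
  axis. On the negative half-line, \<open>Ln\<close> has constant imaginary part \<open>pi\<close>,
  so the principal power is a constant multiple of a power of \<open>- u\<close>, and the positive
  case applies.\<close>

lemma has_vector_derivative_of_real_powr:
  fixes a :: complex and u :: real
  assumes "u \<noteq> 0"
  shows "((\<lambda>u. of_real u powr a) has_vector_derivative a * of_real u powr (a - 1)) (at u)"
proof -
  have pos: "((\<lambda>u. of_real u powr a) has_vector_derivative a * of_real u powr (a - 1)) (at u)"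
    if "u > 0" for u :: real
  proof -
    have "((\<lambda>z. z powr a) \<circ> complex_of_real has_vector_derivative 1 * (a * of_real u powr (a - 1))) (at u)"
      by (rule field_vector_diff_chain_at)
        (use that in \<open>auto intro!: derivative_eq_intros has_field_derivative_powr\<close>)
    then show ?thesis by (simp add: o_def)
  qed
  show ?thesis
  proof (cases "u > 0")
    case False
    with assms have u: "u < 0" by simp
    have neg: "of_real v powr b = exp (\<i> * pi * b) * of_real (- v) powr b" if "v < 0" for v :: real and b :: complex
      using that Ln_of_real'[of v] Ln_of_real[of "- v"]
      by (simp add: powr_def exp_add[symmetric] algebra_simps)
    have "((\<lambda>u. of_real u powr a) \<circ> uminus has_vector_derivative (-1) *\<^sub>R (a * of_real (- u) powr (a - 1))) (at u)"
      by (rule vector_diff_chain_at) (use u pos[of "- u"] in \<open>auto intro!: derivative_eq_intros\<close>)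
    then have "((\<lambda>u. exp (\<i> * pi * a) * of_real (- u) powr a) has_vector_derivative
        exp (\<i> * pi * a) * (- (a * of_real (- u) powr (a - 1)))) (at u)"
      by (intro derivative_eq_intros) (auto simp: o_def)
    \<comment> \<open>The factor for exponent \<open>a - 1\<close> is
      \<open>exp (\<i> * pi * (a - 1))\<close>, which equals \<open>- exp (\<i> * pi * a)\<close>;
      this absorbs the sign from the inner derivative of \<open>- u\<close>.\<close>
    also have "exp (\<i> * pi * a) * (- (a * of_real (- u) powr (a - 1))) = a * of_real u powr (a - 1)"
      by (simp add: neg[OF u] algebra_simps exp_diff)
    finally have "((\<lambda>u. exp (\<i> * pi * a) * of_real (- u) powr a) has_vector_derivative
        a * of_real u powr (a - 1)) (at u)" .
    then show ?thesis
      by (rule has_vector_derivative_transform_within_open[where S = "{..<0}"]) (use u neg in auto)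
  qed (rule pos)
qed

lemma has_vector_derivative_affine_powr:
  fixes a x :: complex and c :: real
  assumes "1 + x * of_real c \<noteq> 0"
  shows "((\<lambda>c. (1 + x * of_real c) powr a) has_vector_derivative
           a * x * (1 + x * of_real c) powr (a - 1)) (at c)"
proof (cases "1 + x * of_real c \<in> \<real>\<^sub>\<le>\<^sub>0")
  case False
  have "((\<lambda>z. z powr a) \<circ> (\<lambda>c. 1 + x * of_real c) has_vector_derivative
      x * (a * (1 + x * of_real c) powr (a - 1))) (at c)"
    by (rule field_vector_diff_chain_at)
      (use False in \<open>auto intro!: derivative_eq_intros has_field_derivative_powr\<close>)
  then show ?thesis by (simp add: o_def mult_ac)
next
  case True
  then have im: "Im x * c = 0" and re: "1 + Re x * c \<le> 0"
    by (auto simp: complex_nonpos_Reals_iff)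
  \<comment> \<open>At \<open>c = 0\<close> the base is 1, off the cut. Hence \<open>c\<close> is
    nonzero, \<open>x\<close> must be real, and the base stays real for every real \<open>c\<close>,
    so the derivative along the real line applies.\<close>
  from re have "c \<noteq> 0" by auto
  with im have x: "x = of_real (Re x)" by (simp add: complex_eq_iff)
  define y where "y = Re x"
  have xy: "x = of_real y" using x by (simp add: y_def)
  have eq: "1 + x * of_real c = of_real (1 + y * c)" for c by (simp add: xy)
  have "1 + y * c \<noteq> 0" using assms unfolding eq by (simp only: of_real_eq_0_iff not_False_eq_True)
  then have "((\<lambda>u. of_real u powr a) \<circ> (\<lambda>c. 1 + y * c) has_vector_derivative
      y *\<^sub>R (a * of_real (1 + y * c) powr (a - 1))) (at c)"
    by (intro vector_diff_chain_at has_vector_derivative_of_real_powr)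
      (auto intro!: derivative_eq_intros)
  then show ?thesis by (simp add: o_def xy scaleR_conv_of_real mult_ac)
qed

lemma has_vector_derivative_powr_cos:
  fixes a x :: complex and t :: real
  assumes "1 + x * of_real (cos t) \<noteq> 0"
  shows "((\<lambda>t. (1 + x * of_real (cos t)) powr a) has_vector_derivative
           - of_real (sin t) * (a * x * (1 + x * of_real (cos t)) powr (a - 1))) (at t)"
proof -
  have "((\<lambda>c. (1 + x * of_real c) powr a) \<circ> cos has_vector_derivative
      (- sin t) *\<^sub>R (a * x * (1 + x * of_real (cos t)) powr (a - 1))) (at t)"
    by (intro vector_diff_chain_at has_vector_derivative_affine_powr assms)
      (auto intro!: derivative_eq_intros simp: has_real_derivative_iff_has_vector_derivative[symmetric])
  then show ?thesis by (simp add: o_def scaleR_conv_of_real)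
qed

text \<open>Where the base is nonzero, differentiability gives continuity. At a zero, the convention
  \<open>0 powr a = 0\<close> matches the limit, which is 0 because \<open>Re a > 0\<close>.\<close>

lemma continuous_powr_cos:
  fixes a x :: complex and t :: real
  assumes "1 + x * of_real (cos t) = 0 \<Longrightarrow> Re a > 0"
  shows "isCont (\<lambda>t. (1 + x * of_real (cos t)) powr a) t"
proof (cases "1 + x * of_real (cos t) = 0")
  case True
  have "((\<lambda>t. 1 + x * of_real (cos t)) \<longlongrightarrow> 1 + x * of_real (cos t)) (at t)"
    by (intro tendsto_intros)
  then show ?thesis
    unfolding isCont_def using True assms by (auto intro!: tendsto_powr_complex_0)
next
  case False
  then show ?thesis
    using has_vector_derivative_powr_cos has_vector_derivative_continuous by blast
qed

text \<open>A zero forces \<open>cos t = - 1 / x\<close>, and \<open>cos\<close> is injective on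
  \<open>{0..pi}\<close>.\<close>

lemma finite_zeros_affine_cos:
  fixes x :: complex
  shows "finite {t \<in> {0..pi}. 1 + x * of_real (cos t) = 0}"
proof (rule finite_imageD)
  show "inj_on cos {t \<in> {0..pi}. 1 + x * of_real (cos t) = 0}"
    by (auto intro!: inj_onI cos_inj_pi)
  have "cos ` {t \<in> {0..pi}. 1 + x * of_real (cos t) = 0} \<subseteq> {Re (- 1 / x)}"
  proof safe
    fix t assume t: "1 + x * of_real (cos t) = 0"
    then have "x \<noteq> 0" by auto
    with t have "of_real (cos t) = - 1 / x"
      by (simp add: field_simps eq_neg_iff_add_eq_0 add.commute)
    then show "cos t = Re (- 1 / x)" by (metis Re_complex_of_real)
  qed
  then show "finite (cos ` {t \<in> {0..pi}. 1 + x * of_real (cos t) = 0})"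
    by (rule finite_subset) simp
qed

text \<open>With \<open>c = cos t\<close>, this shows that the base can vanish only for those
  \<open>x\<close> where the theorem restricts \<open>Re (1 / k)\<close>.\<close>

lemma affine_eq_0_imp_Reals:
  fixes x :: complex and c :: real
  assumes "1 + x * of_real c = 0" and "\<bar>c\<bar> \<le> 1"
  shows "x \<in> \<real>" and "norm x \<ge> 1"
proof -
  from assms have c: "c \<noteq> 0" by auto
  have "x = - 1 / of_real c"
    using assms c by (simp add: field_simps eq_neg_iff_add_eq_0 add.commute)
  then have x: "x = of_real (- 1 / c)" by simp
  then show "x \<in> \<real>" by (metis Reals_of_real)
  show "norm x \<ge> 1" unfolding x norm_of_real using assms c by (simp add: field_simps)
qed

text \<open>Reflection in the midpoint preserves the integral, while oddness negates it.\<close>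

lemma has_integral_antisymmetric_0:
  fixes F :: "real \<Rightarrow> 'a :: banach"
  assumes "continuous_on {0..b} F" and odd: "\<And>t. F (b - t) = - F t"
  shows "(F has_integral 0) {0..b}"
proof -
  obtain i where i: "(F has_integral i) (cbox 0 b)"
    using integrable_continuous_real[OF assms(1)] by auto
  have "((\<lambda>t. F (b - t)) has_integral i) {0..b}"
    using has_integral_affinity[OF i, of "-1" b] by simp
  then have "(F has_integral - i) {0..b}"
    using has_integral_neg[of "\<lambda>t. - F t"] by (simp add: odd)
  then have "i = - i" using i has_integral_unique by (metis cbox_interval)
  then have "2 *\<^sub>R i = 0" by (metis scaleR_2 add.right_inverse)
  then show ?thesis using i by simp
qed

theorem mainTheorem7:
  fixes k x :: complex
  assumes "k \<noteq> 0" and "k \<noteq> -1" and "x \<noteq> 0"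
    and "x \<in> \<real> \<Longrightarrow> norm x \<ge> 1 \<Longrightarrow> Re (1 / k) > -1"
  shows "((\<lambda>\<theta>::real. of_real (\<theta> * sin \<theta>) *
            ((1 + x * of_real (cos \<theta>)) powr (1 / k) + (1 - x * of_real (cos \<theta>)) powr (1 / k)))
          has_integral
          of_real pi * k / ((k + 1) * x) *
            ((1 + x) powr ((k + 1) / k) - (1 - x) powr ((k + 1) / k))) {0..pi}"
proof -
  define a where "a = (k + 1) / k"
  have k1: "k + 1 \<noteq> 0" using assms(2) by (metis add_eq_0_iff2)
  have a0: "a \<noteq> 0" using k1 assms(1) by (simp add: a_def)
  have a1: "1 / k = a - 1" using assms(1) by (simp add: a_def field_simps)
  \<comment> \<open>Since \<open>1 / k = a - 1\<close>, the bound \<open>Re (1 / k) > -1\<close>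
    says exactly that \<open>Re a > 0\<close>.\<close>
  have Rea: "Re a > 0" if "1 + y * of_real (cos t) = 0" "y = x \<or> y = - x" for y t
  proof -
    have "x \<in> \<real>" "norm x \<ge> 1"
      using affine_eq_0_imp_Reals[OF that(1)] that(2) by auto
    then show ?thesis using assms(4) a1 by simp
  qed
  define P where "P = (\<lambda>y t. (1 + y * of_real (cos t)) powr a)"
  define F where "F = (\<lambda>t. (P (- x) t - P x t) / (a * x))"
  define f where "f = (\<lambda>t. of_real (sin t) *
    ((1 + x * of_real (cos t)) powr (a - 1) + (1 - x * of_real (cos t)) powr (a - 1)))"
  define S where "S = {t \<in> {0..pi}. 1 + x * of_real (cos t) = 0} \<union>
                      {t \<in> {0..pi}. 1 + (- x) * of_real (cos t) = 0}"
  have "isCont (P y) t" if "y = x \<or> y = - x" for y t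
    unfolding P_def using Rea that by (intro continuous_powr_cos) auto
  then have contF: "continuous_on {0..pi} F"
    unfolding F_def using a0 assms(3)
    by (intro continuous_intros continuous_at_imp_continuous_on ballI) auto
  have derivF: "(F has_vector_derivative f t) (at t)" if "t \<in> {0<..<pi} - S" for t
  proof -
    have D: "(P y has_vector_derivative
        - of_real (sin t) * (a * y * (1 + y * of_real (cos t)) powr (a - 1))) (at t)"
      if "y = x \<or> y = - x" for y
      unfolding P_def
      by (rule has_vector_derivative_powr_cos) (use that \<open>t \<in> {0<..<pi} - S\<close> in \<open>auto simp: S_def\<close>)
    have "(F has_vector_derivative
       (- of_real (sin t) * (a * (- x) * (1 + (- x) * of_real (cos t)) powr (a - 1))
        - - of_real (sin t) * (a * x * (1 + x * of_real (cos t)) powr (a - 1))) / (a * x)) (at t)"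
      unfolding F_def
      by (intro has_vector_derivative_divide has_vector_derivative_diff D) auto
    also have "(- of_real (sin t) * (a * (- x) * (1 + (- x) * of_real (cos t)) powr (a - 1))
        - - of_real (sin t) * (a * x * (1 + x * of_real (cos t)) powr (a - 1))) / (a * x) = f t"
      using a0 assms(3) by (simp add: f_def field_simps)
    finally show ?thesis .
  qed
  \<comment> \<open>As \<open>cos (pi - t) = - cos t\<close>, the reflection swaps
    \<open>P x\<close> and \<open>P (- x)\<close>.\<close>
  have "F (pi - t) = - F t" for t
    unfolding F_def P_def minus_divide_left by simp
  then have "(F has_integral 0) {0..pi}"
    by (rule has_integral_antisymmetric_0[OF contF])
  \<comment> \<open>The zero integral of \<open>F\<close> is written as the boundary terms minus the
    value claimed for the other integral, the shape that integration by parts expects.\<close>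
  then have by_parts: "((\<lambda>t. F t * 1) has_integral
      F pi * of_real pi - F 0 * of_real 0 - F pi * of_real pi) {0..pi}"
    by simp
  have finS: "finite S"
    unfolding S_def by (intro finite_UnI finite_zeros_affine_cos)
  have cont_of_real: "continuous_on {0..pi} complex_of_real"
    by (intro continuous_intros)
  have deriv_of_real: "(complex_of_real has_vector_derivative 1) (at t)" for t
    by (auto intro!: derivative_eq_intros)
  have "((\<lambda>t. f t * of_real t) has_integral F pi * of_real pi) {0..pi}"
    by (rule integration_by_parts_interior_strong[OF bounded_bilinear_mult finS pi_ge_zero contF
          cont_of_real derivF deriv_of_real by_parts])
  also have "(\<lambda>t. f t * of_real t) = (\<lambda>t. of_real (t * sin t) *
            ((1 + x * of_real (cos t)) powr (1 / k) + (1 - x * of_real (cos t)) powr (1 / k)))"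
    by (simp add: f_def a1 mult_ac)
  \<comment> \<open>Since \<open>cos pi = -1\<close>, \<open>P (- x) pi\<close> is the power of
    \<open>1 + x\<close> and \<open>P x pi\<close> that of \<open>1 - x\<close>.\<close>
  also have "F pi * of_real pi = of_real pi * k / ((k + 1) * x) *
            ((1 + x) powr ((k + 1) / k) - (1 - x) powr ((k + 1) / k))"
    by (simp add: F_def P_def a_def)
  finally show ?thesis .
qed

end
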